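(* Let $E=\{e_1,\dots,e_n\}$ be a fixed orthonormal basis of $\mathbb{C}^n$, $E_i=e_i\otimes e_i$ for $i=1,\dots,n$, and let $S$ be a subspace with $\{0\}\subsetneq S\subsetneq\mathbb{C}^n$. Then $$\operatorname{cone}(m_S)=\operatorname{cone}\big(W(P_SE_1P_S,\,P_SE_2P_S,\dots,P_SE_nP_S)\big).$$
   Context: $\mathbb{C}^n$ has its usual inner product $\langle\cdot,\cdot\rangle$ (linear in the first variable). For $x\in\mathbb{C}^n$ put $x_j=\langle x,e_j\rangle$ and $|x|^2=(|x_1|^2,\dots,|x_n|^2)$. The moment of $S$ is $m_S=\operatorname{conv}\{|v|^2:v\in S,\ \|v\|=1\}\subset\mathbb{R}^n_{\ge0}$, and $P_S$ is the orthogonal projection onto $S$. For a unit vector $x$, $(x\otimes x)(v)=\langle v,x\rangle x$. For hermitian $A_1,\dots,A_m\in M_n(\mathbb{C})$ the joint numerical range is $W(A_1,\dots,A_m)=\{(\operatorname{tr}(A_1\rho),\dots,\operatorname{tr}(A_m\rho)):\rho\in M_n(\mathbb{C}),\ \rho=\rho^*,\ \rho\ge0,\ \operatorname{tr}(\rho)=1\}$. For $X\subset\mathbb{R}^n$, the positive cone generated by $X$ is $\operatorname{cone}(X)=\{t\,x: t\in\mathbb{R}_{\ge0},\ x\in X\}$. *)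

theory Defs
  imports "HOL-Analysis.Analysis"
begin

(* The library's \<bullet> on complex^'n is the real inner product, i.e. the real part of this one. *)
definition cinner :: "complex^'n \<Rightarrow> complex^'n \<Rightarrow> complex" where
  "cinner x y = (\<Sum>i\<in>UNIV. x $ i * cnj (y $ i))"

definition orthonormal_basis :: "('n \<Rightarrow> complex^'n) \<Rightarrow> bool" where
  "orthonormal_basis e \<longleftrightarrow>
     (\<forall>i j. cinner (e i) (e j) = (if i = j then 1 else 0)) \<and> vec.span (range e) = UNIV"

(* |x|^2, the squared moduli of the coordinates of x with respect to the basis e *)
definition sqmod :: "('n \<Rightarrow> complex^'n) \<Rightarrow> complex^'n \<Rightarrow> real^'n" where
  "sqmod e x = (\<chi> j. (cmod (cinner x (e j)))\<^sup>2)"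

definition moment :: "('n \<Rightarrow> complex^'n) \<Rightarrow> (complex^'n) set \<Rightarrow> (real^'n) set" where
  "moment e S = convex hull {sqmod e v | v. v \<in> S \<and> norm v = 1}"

(* the matrix, in the standard coordinates of complex^'n, of x \<otimes> x *)
definition rank_one :: "complex^'n \<Rightarrow> complex^'n^'n" where
  "rank_one x = matrix (\<lambda>v. cinner v x *s x)"

(* For a complex subspace S the described point exists and is unique: lemma ex1_orth_proj below. *)
definition orth_proj :: "(complex^'n) set \<Rightarrow> complex^'n \<Rightarrow> complex^'n" where
  "orth_proj S x = (THE p. p \<in> S \<and> (\<forall>y\<in>S. cinner (x - p) y = 0))"

definition proj_matrix :: "(complex^'n) set \<Rightarrow> complex^'n^'n" where
  "proj_matrix S = matrix (orth_proj S)"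

definition adjoint_matrix :: "complex^'n^'n \<Rightarrow> complex^'n^'n" where
  "adjoint_matrix A = map_matrix cnj (transpose A)"

definition pos_semidef :: "complex^'n^'n \<Rightarrow> bool" where
  "pos_semidef A \<longleftrightarrow> (\<forall>v. cinner (A *v v) v \<in> \<real>\<^sub>\<ge>\<^sub>0)"

definition density_matrix :: "complex^'n^'n \<Rightarrow> bool" where
  "density_matrix \<rho> \<longleftrightarrow> \<rho> = adjoint_matrix \<rho> \<and> pos_semidef \<rho> \<and> trace \<rho> = 1"

(* For hermitian A i the traces are real, so every density matrix contributes a point. *)
definition joint_numerical_range :: "('m \<Rightarrow> complex^'n^'n) \<Rightarrow> (real^'m) set" where
  "joint_numerical_range A =
     {w. \<exists>\<rho>. density_matrix \<rho> \<and> (\<forall>i. complex_of_real (w $ i) = trace (A i ** \<rho>))}"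

(* The set of nonnegative multiples of points of X; the library's cone is the predicate
   "closed under nonnegative scaling", and cone hull X is this same set. *)
definition pos_cone :: "'a::real_vector set \<Rightarrow> 'a set" where
  "pos_cone X = {t *\<^sub>R x | t x. 0 \<le> t \<and> x \<in> X}"

lemma pos_cone_eq_cone_hull: "pos_cone X = cone hull X"
  by (simp add: pos_cone_def cone_hull_expl)

lemma inner_eq_Re_cinner: "x \<bullet> y = Re (cinner x y)"
  by (simp add: cinner_def inner_vec_def inner_complex_def)

lemma cinner_scale_right: "cinner x (c *s y) = cnj c * cinner x y"
  by (simp add: cinner_def sum_distrib_left algebra_simps)

lemma cinner_scale_left: "cinner (c *s x) y = c * cinner x y"
  by (simp add: cinner_def sum_distrib_left algebra_simps)

lemma cinner_add_left: "cinner (x + z) y = cinner x y + cinner z y"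
  by (simp add: cinner_def sum.distrib algebra_simps)

lemma ex1_orth_proj:
  fixes S :: "(complex^'n) set"
  assumes S: "vec.subspace S"
  shows "\<exists>!p. p \<in> S \<and> (\<forall>y\<in>S. cinner (x - p) y = 0)"
proof -
  have scaleR: "r *\<^sub>R v = complex_of_real r *s v" for r and v :: "complex^'n"
    by (rule iffD2[OF vec_eq_iff]) (simp add: complex_eq_iff)
  have "subspace S"
    using S unfolding subspace_def vec.subspace_def scaleR by blast
  then have span: "span S = S"
    by simp
  obtain p z where p: "p \<in> S" and z: "\<And>w. w \<in> S \<Longrightarrow> orthogonal z w" and x: "x = p + z"
    using orthogonal_subspace_decomp_exists[of S x] unfolding span by metis
  have "cinner (x - p) y = 0" if y: "y \<in> S" for y
  proof -
    have "\<i> *s y \<in> S"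
      using S y by (rule vec.subspace_scale)
    then have "z \<bullet> y = 0" "z \<bullet> (\<i> *s y) = 0"
      using z y by (auto simp: orthogonal_def)
    then show ?thesis
      by (simp add: x inner_eq_Re_cinner cinner_scale_right complex_eq_iff)
  qed
  moreover have "q = p" if q: "q \<in> S" "\<forall>y\<in>S. cinner (x - q) y = 0" for q
  proof -
    have pq: "q - p \<in> S"
      using S q(1) p by (rule vec.subspace_diff)
    then have "(x - p) \<bullet> (q - p) = 0" "(x - q) \<bullet> (q - p) = 0"
      using calculation q(2) by (simp_all add: inner_eq_Re_cinner)
    then have "(q - p) \<bullet> (q - p) = 0"
      by (simp add: inner_diff_left)
    then show ?thesis
      by simp
  qed
  ultimately show ?thesis
    using p by blast
qed

lemma orth_proj_props:
  assumes "vec.subspace S"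
  shows "orth_proj S x \<in> S \<and> (\<forall>y\<in>S. cinner (x - orth_proj S x) y = 0)"
  unfolding orth_proj_def by (rule theI'[OF ex1_orth_proj[OF assms]])

lemmas orth_proj_in = orth_proj_props[THEN conjunct1]
  and cinner_orth_proj = orth_proj_props[THEN conjunct2, rule_format]

lemma orth_proj_eqI:
  assumes "vec.subspace S" "p \<in> S" "\<And>y. y \<in> S \<Longrightarrow> cinner (x - p) y = 0"
  shows "orth_proj S x = p"
  unfolding orth_proj_def
  by (rule the1_equality[OF ex1_orth_proj[OF assms(1)]]) (simp add: assms(2,3))

lemma proj_matrix_works:
  assumes S: "vec.subspace S"
  shows "proj_matrix S *v x = orth_proj S x"
proof -
  have add: "orth_proj S (x + y) = orth_proj S x + orth_proj S y" for x y
  proof (rule orth_proj_eqI[OF S])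
    show "orth_proj S x + orth_proj S y \<in> S"
      using S by (simp add: vec.subspace_add orth_proj_in)
    fix v assume "v \<in> S"
    then show "cinner (x + y - (orth_proj S x + orth_proj S y)) v = 0"
      by (simp only: add_diff_add cinner_add_left cinner_orth_proj[OF S] add_0_left)
  qed
  have scale: "orth_proj S (c *s x) = c *s orth_proj S x" for c x
  proof (rule orth_proj_eqI[OF S])
    show "c *s orth_proj S x \<in> S"
      using S by (simp add: vec.subspace_scale orth_proj_in)
    fix v assume "v \<in> S"
    then have "cinner (c *s (x - orth_proj S x)) v = 0"
      by (simp only: cinner_scale_left cinner_orth_proj[OF S] mult_zero_right)
    then show "cinner (c *s x - c *s orth_proj S x) v = 0"
      by (simp only: vec.scale_right_diff_distrib)
  qed
  have "Vector_Spaces.linear (*s) (*s) (orth_proj S)"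
    by unfold_locales (simp_all add: add scale)
  then show ?thesis
    unfolding proj_matrix_def by (rule matrix_works)
qed

lemma rank_one_works: "rank_one x *v v = cinner v x *s x"
proof -
  have "Vector_Spaces.linear (*s) (*s) (\<lambda>v. cinner v x *s x)"
    by unfold_locales
      (simp_all add: cinner_add_left cinner_scale_left vec.scale_left_distrib)
  then show ?thesis
    unfolding rank_one_def by (rule matrix_works)
qed

end

theory Submission
  imports Defs
begin

(* Every positive semidefinite matrix is a sum of matrices v \<otimes> v (Cholesky elimination), and for
   such a matrix the trace against P_S E_i P_S is |\<langle>P_S v, e_i\<rangle>|^2.  So the points of the joint
   numerical range are sums of vectors |P_S v|^2, which lie in the convex cone over m_S.
   Conversely, for a unit vector v of S the density matrix v \<otimes> v yields the point |v|^2, and the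
   joint numerical range is convex. *)

section \<open>Algebra of the complex inner product\<close>

lemma cinner_commute: "cinner y x = cnj (cinner x y)"
  by (simp add: cinner_def mult.commute)

lemma cinner_add_right: "cinner x (y + z) = cinner x y + cinner x z"
  by (simp add: cinner_def sum.distrib algebra_simps)

lemma cinner_diff_left: "cinner (x - z) y = cinner x y - cinner z y"
  by (simp add: cinner_def sum_subtractf algebra_simps)

lemma cinner_zero [simp]: "cinner 0 x = 0" "cinner x 0 = 0"
  by (simp_all add: cinner_def)

lemma cinner_self: "cinner x x = complex_of_real ((norm x)\<^sup>2)"
proof (rule complex_eqI)
  show "Re (cinner x x) = Re (complex_of_real ((norm x)\<^sup>2))"
    by (simp add: dot_square_norm flip: inner_eq_Re_cinner)
  show "Im (cinner x x) = Im (complex_of_real ((norm x)\<^sup>2))"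
    using arg_cong[OF cinner_commute[of x x], of Im] by simp
qed

lemma cinner_axis: "cinner x (axis k 1) = x $ k"
proof -
  have "cinner x (axis k 1) = (\<Sum>i\<in>UNIV. if i = k then x $ i else 0)"
    unfolding cinner_def by (rule sum.cong) (auto simp: axis_def)
  then show ?thesis by simp
qed

lemma matrix_vector_mult_axis:
  fixes A :: "'a::semiring_1^'n^'m"
  shows "(A *v axis k 1) $ i = A $ i $ k"
proof -
  have "(A *v axis k 1) $ i = (\<Sum>j\<in>UNIV. if j = k then A $ i $ j else 0)"
    unfolding matrix_vector_mult_def vec_lambda_beta by (rule sum.cong) (simp_all add: axis_def)
  then show ?thesis by simp
qed

section \<open>Orthogonal projections and compressions to S\<close>

lemma orth_proj_id:
  assumes "vec.subspace S" "v \<in> S"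
  shows "orth_proj S v = v"
  by (rule orth_proj_eqI) (use assms in auto)

text \<open>Both sides equal the inner product of the two projections, because each residual is
  orthogonal to S.\<close>

lemma cinner_orth_proj_swap:
  assumes "vec.subspace S"
  shows "cinner (orth_proj S x) y = cinner x (orth_proj S y)"
proof -
  have "cinner (x - orth_proj S x) (orth_proj S y) = 0"
    "cinner (y - orth_proj S y) (orth_proj S x) = 0"
    using assms by (simp_all add: cinner_orth_proj orth_proj_in)
  then show ?thesis
    using cinner_commute[of "orth_proj S x" "orth_proj S y"] cinner_commute[of "orth_proj S x" y]
    by (simp add: cinner_diff_left)
qed

lemma cinner_compress_rank_one:
  assumes "vec.subspace S"
  shows "cinner ((proj_matrix S ** rank_one x ** proj_matrix S) *v v) v =
    complex_of_real ((cmod (cinner (orth_proj S v) x))\<^sup>2)"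
proof -
  define b where "b = cinner (orth_proj S v) x"
  have "cinner ((proj_matrix S ** rank_one x ** proj_matrix S) *v v) v = b * cinner x (orth_proj S v)"
    \<comment> \<open>Restricting the swap to vectors \<open>b *s x\<close> moves only the outer
      projection and leaves the scalar \<open>cinner (orth_proj S v) x\<close> alone.\<close>
    by (simp add: b_def proj_matrix_works[OF assms] rank_one_works
        cinner_orth_proj_swap[OF assms, of "b *s x" for b] cinner_scale_left
        flip: matrix_vector_mul_assoc)
  also have "cinner x (orth_proj S v) = cnj b"
    unfolding b_def by (rule cinner_commute)
  finally show ?thesis
    unfolding b_def complex_norm_square .
qed

section \<open>Rank-one matrices, traces and adjoints\<close>

lemma rank_one_nth: "rank_one x $ i $ j = x $ i * cnj (x $ j)"
proof -
  have "rank_one x $ i $ j = (rank_one x *v axis j 1) $ i"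
    by (simp add: matrix_vector_mult_axis)
  also have "\<dots> = x $ i * cnj (x $ j)"
    unfolding rank_one_works
    using cinner_commute[of "axis j 1" x] by (simp add: cinner_axis)
  finally show ?thesis .
qed

text \<open>Turns the traces that define the joint numerical range into values of quadratic
  forms.\<close>

lemma trace_mult_rank_one: "trace (A ** rank_one v) = cinner (A *v v) v"
  by (simp add: trace_def matrix_matrix_mult_def matrix_vector_mult_def cinner_def
      rank_one_nth sum_distrib_right mult.assoc)

lemma trace_rank_one: "trace (rank_one v) = cinner v v"
  by (simp add: trace_def cinner_def rank_one_nth)

lemma adjoint_rank_one: "adjoint_matrix (rank_one x) = rank_one x"
  by (simp add: adjoint_matrix_def vec_eq_iff map_matrix_def transpose_def rank_one_nth)

lemma adjoint_diff: "adjoint_matrix (A - B) = adjoint_matrix A - adjoint_matrix B"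
  by (simp add: adjoint_matrix_def vec_eq_iff map_matrix_def transpose_def)

lemma cinner_adjoint: "cinner (A *v x) y = cinner x (adjoint_matrix A *v y)"
proof -
  have "cinner (A *v x) y = (\<Sum>i\<in>UNIV. \<Sum>j\<in>UNIV. A $ i $ j * x $ j * cnj (y $ i))"
    by (simp add: cinner_def matrix_vector_mult_def sum_distrib_right)
  also have "\<dots> = (\<Sum>j\<in>UNIV. \<Sum>i\<in>UNIV. A $ i $ j * x $ j * cnj (y $ i))"
    by (rule sum.swap)
  also have "\<dots> = cinner x (adjoint_matrix A *v y)"
    by (simp add: cinner_def matrix_vector_mult_def adjoint_matrix_def map_matrix_def
        transpose_def sum_distrib_left mult_ac)
  finally show ?thesis .
qed

lemma cinner_rank_one_self:
  "cinner (rank_one x *v v) v = complex_of_real ((cmod (cinner v x))\<^sup>2)"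
  unfolding rank_one_works cinner_scale_left complex_norm_square
  by (subst cinner_commute[of v x]) simp

lemma pos_semidef_rank_one: "pos_semidef (rank_one x)"
  by (simp add: pos_semidef_def cinner_rank_one_self del: of_real_power)

lemma pos_semidef_self:
  assumes "pos_semidef A"
  shows "0 \<le> Re (cinner (A *v v) v)"
    and "cinner (A *v v) v = complex_of_real (Re (cinner (A *v v) v))"
  using assms unfolding pos_semidef_def complex_nonneg_Reals_iff
  by (auto simp: complex_eq_iff)

section \<open>Cauchy-Schwarz for semidefinite hermitian forms\<close>

lemma cinner_hermitian_swap:
  assumes "A = adjoint_matrix A"
  shows "cinner (A *v v) u = cnj (cinner (A *v u) v)"
  using cinner_adjoint[of A v u] cinner_commute[of v "A *v u"] assms by simp

text \<open>For hermitian \<open>A\<close> the two cross terms are complex conjugates, so together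
  they give twice a real part.\<close>

lemma cinner_form_add_scale:
  assumes "A = adjoint_matrix A"
  shows "Re (cinner (A *v (u + c *s v)) (u + c *s v)) =
    Re (cinner (A *v u) u) + 2 * Re (cnj c * cinner (A *v u) v)
      + (cmod c)\<^sup>2 * Re (cinner (A *v v) v)"
proof -
  have "cinner (A *v (u + c *s v)) (u + c *s v) =
    cinner (A *v u) u + cnj c * cinner (A *v u) v + cnj (cnj c * cinner (A *v u) v)
      + (c * cnj c) * cinner (A *v v) v"
    using cinner_hermitian_swap[OF assms, of v u]
    by (simp add: matrix_vector_right_distrib vector_scalar_commute
        cinner_add_left cinner_add_right cinner_scale_left cinner_scale_right algebra_simps)
  then show ?thesis
    by (simp flip: complex_norm_square)
qed

lemma pos_semidef_Cauchy_Schwarz: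
  assumes h: "A = adjoint_matrix A" and p: "pos_semidef A"
  shows "(cmod (cinner (A *v u) v))\<^sup>2 \<le> Re (cinner (A *v u) u) * Re (cinner (A *v v) v)"
proof -
  define q where "q x = Re (cinner (A *v x) x)" for x
  have q0: "0 \<le> q x" for x
    unfolding q_def by (rule pos_semidef_self(1)[OF p])
  \<comment> \<open>Nonnegativity of the form at x - t b y, where b is
    \<open>cinner (A *v x) y\<close>. The factor b makes the cross term real, which leaves a
    quadratic in the real number t.\<close>
  have gen: "0 \<le> q x - 2 * t * (cmod (cinner (A *v x) y))\<^sup>2
      + t\<^sup>2 * (cmod (cinner (A *v x) y))\<^sup>2 * q y" for x y t
  proof -
    define b where "b = cinner (A *v x) y"
    have "q (x + (- (of_real t * b)) *s y) = q x + 2 * Re (cnj (- (of_real t * b)) * b)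
        + (cmod (- (of_real t * b)))\<^sup>2 * q y"
      unfolding q_def b_def by (rule cinner_form_add_scale[OF h])
    also have "cnj (- (of_real t * b)) * b = - of_real (t * (cmod b)\<^sup>2)"
      by (simp only: of_real_mult complex_norm_square) simp
    also have "(cmod (- (of_real t * b)))\<^sup>2 = t\<^sup>2 * (cmod b)\<^sup>2"
      by (simp add: norm_mult power_mult_distrib)
    finally show ?thesis
      using q0[of "x + (- (of_real t * b)) *s y"] by (simp add: b_def)
  qed
  \<comment> \<open>The choice t = 1 / \<open>q y\<close> minimises the quadratic.\<close>
  have pos: "(cmod (cinner (A *v x) y))\<^sup>2 \<le> q x * q y" if "q y \<noteq> 0" for x y
    using gen[of x "1 / q y" y] that q0[of y] by (simp add: field_simps power2_eq_square)
  \<comment> \<open>The form may be degenerate. If \<open>q v\<close> vanishes but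
    \<open>q u\<close> does not, \<open>u\<close> and \<open>v\<close> change roles; if both vanish,
    t = 1 leaves 0 \<le> -2 |b|^2, which forces b = 0.\<close>
  consider "q v \<noteq> 0" | "q u \<noteq> 0" | "q u = 0" "q v = 0" by blast
  then show ?thesis
  proof cases
    case 1
    then show ?thesis using pos[of v u] by (simp add: q_def)
  next
    case 2
    then show ?thesis
      using pos[of u v] cinner_hermitian_swap[OF h, of v u] by (simp add: q_def mult.commute)
  next
    case 3
    then show ?thesis using gen[of u 1 v] by (simp add: q_def)
  qed
qed

section \<open>Cholesky elimination\<close>

lemma matrix_eq_0_if_axis:
  fixes A :: "complex^'n^'n"
  assumes "\<And>k. A *v axis k 1 = 0"
  shows "A = 0"
proof -
  have "A $ i $ k = 0" for i k
    using assms[of k] matrix_vector_mult_axis[of A k i] by simp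
  then show ?thesis by (simp add: vec_eq_iff)
qed

text \<open>Induction on the number of nonzero columns: subtracting a suitable rank-one matrix
  clears one column, revives none, and preserves semidefiniteness.\<close>

lemma pos_semidef_sum_rank_one:
  fixes A :: "complex^'n^'n"
  assumes "A = adjoint_matrix A" and "pos_semidef A"
  shows "\<exists>vs. A = (\<Sum>v\<leftarrow>vs. rank_one v)"
  using assms
proof (induction "card {k. A *v axis k 1 \<noteq> 0}" arbitrary: A rule: less_induct)
  case less
  note h = less.prems(1) and p = less.prems(2)
  show ?case
  proof (cases "\<forall>k. A *v axis k 1 = 0")
    case True
    then have "A = (\<Sum>v\<leftarrow>[]. rank_one v)" using matrix_eq_0_if_axis[of A] by simp
    then show ?thesis by blast
  next
    case False
    then obtain k where k: "A *v axis k 1 \<noteq> 0" by blast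
    define a where "a = axis k (1::complex)"
    define d where "d = Re (cinner (A *v a) a)"
    \<comment> \<open>A zero pivot \<open>d\<close> would force the whole column
      \<open>A *v a\<close> to vanish, by Cauchy-Schwarz for \<open>a\<close> and
      \<open>A *v a\<close>.\<close>
    have "0 < (cmod (cinner (A *v a) (A *v a)))\<^sup>2"
      using k by (simp add: cinner_self a_def)
    also have "\<dots> \<le> d * Re (cinner (A *v (A *v a)) (A *v a))"
      unfolding d_def by (rule pos_semidef_Cauchy_Schwarz[OF h p])
    finally have d: "0 < d"
      using pos_semidef_self(1)[OF p, of a]
      by (cases "d = 0") (simp_all add: d_def)
    \<comment> \<open>Scaled so that \<open>rank_one x\<close> sends \<open>a\<close> to
      \<open>A *v a\<close>; the difference \<open>B\<close> is then zero on
      \<open>a\<close>.\<close>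
    define x where "x = complex_of_real (1 / sqrt d) *s (A *v a)"
    define B where "B = A - rank_one x"
    \<comment> \<open>Since \<open>A\<close> is hermitian, this inner product vanishes whenever
      \<open>A *v v\<close> does, so zero columns of \<open>A\<close> stay zero in
      \<open>B\<close>.\<close>
    have vx: "cinner v x = complex_of_real (1 / sqrt d) * cinner (A *v v) a" for v
      unfolding x_def cinner_scale_right
      using cinner_adjoint[of A v a] h by simp
    have hB: "B = adjoint_matrix B"
      unfolding B_def adjoint_diff adjoint_rank_one using h by simp
    have pB: "pos_semidef B"
      unfolding pos_semidef_def
    proof
      fix v
      have "(cmod (cinner v x))\<^sup>2 = (cmod (cinner (A *v v) a))\<^sup>2 / d"
        using d by (simp add: vx norm_mult norm_divide power_mult_distrib power_divide)
      \<comment> \<open>Cauchy-Schwarz against \<open>a\<close>, divided by \<open>d\<close>, is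
        exactly the semidefiniteness of \<open>B\<close> at \<open>v\<close>.\<close>
      also have "\<dots> \<le> Re (cinner (A *v v) v)"
        using pos_semidef_Cauchy_Schwarz[OF h p, of v a] d by (simp add: d_def field_simps)
      finally have le: "(cmod (cinner v x))\<^sup>2 \<le> Re (cinner (A *v v) v)" .
      have "cinner (B *v v) v =
          complex_of_real (Re (cinner (A *v v) v) - (cmod (cinner v x))\<^sup>2)"
        unfolding B_def matrix_vector_mult_diff_rdistrib cinner_diff_left cinner_rank_one_self
          of_real_diff pos_semidef_self(2)[OF p, of v, symmetric] ..
      then show "cinner (B *v v) v \<in> \<real>\<^sub>\<ge>\<^sub>0"
        using le by (simp del: of_real_diff)
    qed
    have Bv: "B *v v = A *v v - cinner v x *s x" for v
      by (simp add: B_def matrix_vector_mult_diff_rdistrib rank_one_works)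
    have "B *v a = 0"
    proof -
      have Aa: "cinner (A *v a) a = complex_of_real d"
        unfolding d_def by (rule pos_semidef_self(2)[OF p])
      have "cinner a x * complex_of_real (1 / sqrt d) =
          complex_of_real (1 / sqrt d * d * (1 / sqrt d))"
        unfolding vx Aa of_real_mult by (rule refl)
      also have "1 / sqrt d * d * (1 / sqrt d) = 1"
        using d by (simp add: field_simps)
      finally have "cinner a x *s x = A *v a"
        by (simp add: x_def del: of_real_divide)
      then show ?thesis by (simp add: Bv)
    qed
    moreover have "B *v v = 0" if "A *v v = 0" for v
      by (simp add: Bv vx that)
    ultimately have "{j. B *v axis j 1 \<noteq> 0} \<subset> {j. A *v axis j 1 \<noteq> 0}"
      using k unfolding a_def by blast
    then have "card {j. B *v axis j 1 \<noteq> 0} < card {j. A *v axis j 1 \<noteq> 0}"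
      by (intro psubset_card_mono) simp_all
    from less.hyps[OF this hB pB] obtain vs where "B = (\<Sum>v\<leftarrow>vs. rank_one v)" by blast
    then have "A = (\<Sum>v\<leftarrow>x # vs. rank_one v)"
      by (simp add: B_def algebra_simps)
    then show ?thesis by blast
  qed
qed

section \<open>Sums of rank-one matrices and convexity of the joint numerical range\<close>

lemma trace_mult_sum_list_rank_one:
  "trace (A ** (\<Sum>v\<leftarrow>vs. rank_one v)) = (\<Sum>v\<leftarrow>vs. cinner (A *v v) v)"
  by (induction vs)
    (simp_all add: matrix_add_ldistrib trace_add trace_mult_rank_one trace_0[unfolded mat_0])

lemma sum_list_vec_nth: "(\<Sum>v\<leftarrow>vs. f v) $ i = (\<Sum>v\<leftarrow>vs. f v $ i)"
  by (induction vs) simp_all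

lemma of_real_sum_list: "of_real (\<Sum>v\<leftarrow>vs. f v) = (\<Sum>v\<leftarrow>vs. of_real (f v))"
  by (induction vs) simp_all

text \<open>A convex combination of density matrices is a density matrix, and the trace pairing is
  linear in it.\<close>

lemma convex_joint_numerical_range: "convex (joint_numerical_range A)"
proof (rule convexI)
  fix w z :: "real^'a" and s t :: real
  assume w: "w \<in> joint_numerical_range A" and z: "z \<in> joint_numerical_range A"
    and st: "0 \<le> s" "0 \<le> t" "s + t = 1"
  obtain \<rho> where r: "density_matrix \<rho>" "\<And>i. complex_of_real (w $ i) = trace (A i ** \<rho>)"
    using w by (auto simp: joint_numerical_range_def)
  obtain \<sigma> where q: "density_matrix \<sigma>" "\<And>i. complex_of_real (z $ i) = trace (A i ** \<sigma>)"
    using z by (auto simp: joint_numerical_range_def)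
  define \<tau> where "\<tau> = s *\<^sub>R \<rho> + t *\<^sub>R \<sigma>"
  have tr: "trace (B ** \<tau>) = of_real s * trace (B ** \<rho>) + of_real t * trace (B ** \<sigma>)" for B
  proof -
    have "trace (B ** \<tau>) = s *\<^sub>R trace (B ** \<rho>) + t *\<^sub>R trace (B ** \<sigma>)"
      by (simp add: \<tau>_def trace_def matrix_matrix_mult_def sum.distrib distrib_left
          scaleR_sum_right)
    then show ?thesis by (simp add: scaleR_conv_of_real)
  qed
  have "adjoint_matrix \<tau> = s *\<^sub>R adjoint_matrix \<rho> + t *\<^sub>R adjoint_matrix \<sigma>"
    by (simp add: \<tau>_def adjoint_matrix_def vec_eq_iff map_matrix_def transpose_def)
  then have "\<tau> = adjoint_matrix \<tau>"
    using r(1) q(1) by (simp add: \<tau>_def density_matrix_def)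
  moreover have "pos_semidef \<tau>"
    unfolding pos_semidef_def
  proof
    fix v
    have "cinner (\<tau> *v v) v = s *\<^sub>R cinner (\<rho> *v v) v + t *\<^sub>R cinner (\<sigma> *v v) v"
      by (simp add: \<tau>_def matrix_vector_mult_def cinner_def sum.distrib distrib_right
          scaleR_sum_right sum_distrib_right)
    then have "cinner (\<tau> *v v) v = of_real s * cinner (\<rho> *v v) v + of_real t * cinner (\<sigma> *v v) v"
      by (simp only: scaleR_conv_of_real)
    then show "cinner (\<tau> *v v) v \<in> \<real>\<^sub>\<ge>\<^sub>0"
      using r(1) q(1) st
      by (auto simp: density_matrix_def pos_semidef_def
          intro!: nonneg_Reals_add_I nonneg_Reals_mult_I)
  qed
  moreover have "trace \<tau> = 1"
    \<comment> \<open>Normalisation is the trace identity for the identity matrix.\<close>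
    using tr[of "mat 1"] r(1) q(1) st(3) by (simp add: density_matrix_def flip: of_real_add)
  ultimately have "density_matrix \<tau>" by (simp add: density_matrix_def)
  moreover have "complex_of_real ((s *\<^sub>R w + t *\<^sub>R z) $ i) = trace (A i ** \<tau>)" for i
    by (simp add: tr r(2) q(2))
  ultimately show "s *\<^sub>R w + t *\<^sub>R z \<in> joint_numerical_range A"
    unfolding joint_numerical_range_def by blast
qed

section \<open>The cone over the moment\<close>

lemma sqmod_in_pos_cone_moment:
  assumes S: "vec.subspace S" "{0} \<subset> S" and v: "v \<in> S"
  shows "sqmod e v \<in> pos_cone (moment e S)"
proof -
  have scaleR: "r *\<^sub>R x = complex_of_real r *s x" for r and x :: "complex^'n"
    by (rule iffD2[OF vec_eq_iff]) (simp add: complex_eq_iff)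
  \<comment> \<open>Normalising \<open>x\<close> inside S pulls out the squared norm, as
    \<open>sqmod\<close> is homogeneous of degree two.\<close>
  have unit: "\<exists>y\<in>moment e S. sqmod e x = (norm x)\<^sup>2 *\<^sub>R y" if x: "x \<in> S" "x \<noteq> 0" for x
  proof -
    define u where "u = complex_of_real (1 / norm x) *s x"
    have "u \<in> S"
      unfolding u_def using S(1) x(1) by (rule vec.subspace_scale)
    moreover have "norm u = 1"
      unfolding u_def scaleR[symmetric] using x(2) by simp
    ultimately have "sqmod e u \<in> moment e S"
      unfolding moment_def by (intro hull_inc) blast
    moreover have "sqmod e x = (norm x)\<^sup>2 *\<^sub>R sqmod e u"
      using x(2) by (simp add: vec_eq_iff sqmod_def u_def cinner_scale_left norm_mult norm_divide
          power_mult_distrib power_divide)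
    ultimately show ?thesis by blast
  qed
  show ?thesis
  proof (cases "v = 0")
    case True
    \<comment> \<open>The zero point is 0 times a point of the moment, which requires the moment to
      be nonempty: the \<open>pos_cone\<close> of the empty set is empty.\<close>
    obtain x where "x \<in> S" "x \<noteq> 0" using S(2) by blast
    then obtain y where "y \<in> moment e S" using unit by blast
    moreover have "sqmod e v = 0 *\<^sub>R y"
      by (simp add: True vec_eq_iff sqmod_def)
    ultimately show ?thesis unfolding pos_cone_def by blast
  next
    case False
    then show ?thesis
      using unit[OF v] unfolding pos_cone_def by (force intro: zero_le_power2)
  qed
qed

text \<open>The cone over a convex set is a convex cone, and convex cones are closed under
  addition.\<close>

lemma pos_cone_add:
  assumes "convex X" "x \<in> pos_cone X" "y \<in> pos_cone X"
  shows "x + y \<in> pos_cone X"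
proof -
  have "convex (cone hull X) \<and> cone (cone hull X)"
    using convex_cone_hull[OF assms(1)] cone_cone_hull[of X] by blast
  then show ?thesis
    using assms(2,3) unfolding convex_cone pos_cone_eq_cone_hull by blast
qed

section \<open>The two inclusions\<close>

lemma joint_numerical_range_subset:
  assumes S: "vec.subspace S" "{0} \<subset> S"
  shows "joint_numerical_range (\<lambda>i. proj_matrix S ** rank_one (e i) ** proj_matrix S)
    \<subseteq> pos_cone (moment e S)"
proof
  fix w assume "w \<in> joint_numerical_range (\<lambda>i. proj_matrix S ** rank_one (e i) ** proj_matrix S)"
  then obtain \<rho> where r: "density_matrix \<rho>"
    and w: "\<And>i. complex_of_real (w $ i) = trace (proj_matrix S ** rank_one (e i) ** proj_matrix S ** \<rho>)"
    by (auto simp: joint_numerical_range_def)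
  obtain vs where vs: "\<rho> = (\<Sum>v\<leftarrow>vs. rank_one v)"
    using pos_semidef_sum_rank_one r unfolding density_matrix_def by blast
  have "complex_of_real (w $ i) = complex_of_real ((\<Sum>v\<leftarrow>vs. sqmod e (orth_proj S v)) $ i)" for i
    unfolding w vs trace_mult_sum_list_rank_one cinner_compress_rank_one[OF S(1)]
      sum_list_vec_nth of_real_sum_list by (simp add: sqmod_def)
  then have "w = (\<Sum>v\<leftarrow>vs. sqmod e (orth_proj S v))"
    unfolding vec_eq_iff of_real_eq_iff by blast
  also have "\<dots> \<in> pos_cone (moment e S)"
  proof (induction vs)
    case Nil
    \<comment> \<open>The empty sum is covered by the zero vector of S.\<close>
    have "sqmod e 0 \<in> pos_cone (moment e S)"
      using S by (intro sqmod_in_pos_cone_moment) auto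
    moreover have "sqmod e 0 = 0" by (simp add: vec_eq_iff sqmod_def)
    ultimately show ?case by simp
  next
    case (Cons v vs)
    have "convex (moment e S)" by (simp add: moment_def)
    then show ?case
      using pos_cone_add[OF _ sqmod_in_pos_cone_moment[OF S orth_proj_in[OF S(1)]] Cons] by simp
  qed
  finally show "w \<in> pos_cone (moment e S)" .
qed

lemma moment_subset_joint_numerical_range:
  assumes S: "vec.subspace S"
  shows "moment e S \<subseteq> joint_numerical_range (\<lambda>i. proj_matrix S ** rank_one (e i) ** proj_matrix S)"
  unfolding moment_def
\<comment> \<open>The range is convex, so only the generators of the moment have to be
  realised.\<close>
proof (rule hull_minimal[where S = convex, OF _ convex_joint_numerical_range], safe)
  fix v assume v: "v \<in> S" "norm v = 1"
  have "density_matrix (rank_one v)"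
    using v(2) by (simp add: density_matrix_def adjoint_rank_one pos_semidef_rank_one
        trace_rank_one cinner_self)
  moreover have "complex_of_real (sqmod e v $ i) =
      trace (proj_matrix S ** rank_one (e i) ** proj_matrix S ** rank_one v)" for i
    unfolding trace_mult_rank_one cinner_compress_rank_one[OF S] orth_proj_id[OF S v(1)]
    by (simp add: sqmod_def)
  ultimately show "sqmod e v \<in>
      joint_numerical_range (\<lambda>i. proj_matrix S ** rank_one (e i) ** proj_matrix S)"
    unfolding joint_numerical_range_def by blast
qed

theorem proposition6p5:
  fixes e :: "'n \<Rightarrow> complex^'n" and S :: "(complex^'n) set"
  assumes "orthonormal_basis e"
    and "vec.subspace S"
    and "{0} \<subset> S"
    and "S \<subset> UNIV"
  shows "pos_cone (moment e S) =
    pos_cone (joint_numerical_range (\<lambda>i. proj_matrix S ** rank_one (e i) ** proj_matrix S))"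
proof
  show "pos_cone (moment e S) \<subseteq>
      pos_cone (joint_numerical_range (\<lambda>i. proj_matrix S ** rank_one (e i) ** proj_matrix S))"
    unfolding pos_cone_eq_cone_hull
    by (rule hull_mono[OF moment_subset_joint_numerical_range[OF assms(2)]])
  \<comment> \<open>Here the range itself lies only in the cone, not in the moment: a density matrix
    supported on the orthogonal complement of S yields the point 0, whereas points of the moment
    have coordinate sum 1. Minimality of the cone hull then suffices.\<close>
  show "pos_cone (joint_numerical_range (\<lambda>i. proj_matrix S ** rank_one (e i) ** proj_matrix S))
      \<subseteq> pos_cone (moment e S)"
    using joint_numerical_range_subset[OF assms(2,3)]
    unfolding pos_cone_eq_cone_hull by (rule hull_minimal) (rule cone_cone_hull)
qed

end
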